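(* For every $w\in S_n$, the chromatic polynomial of the inversion graph $G_w$ satisfies $$\chi_{G_w}(t)=\sum_{i=0}^{n} r_{n-i}(O_w)\,t(t-1)\cdots(t-i+1),$$ where $r_k(O_w)$ is the number of placements of $k$ non-attacking rooks on $O_w$.
   Context: For $w=w_1\cdots w_n\in S_n$, the inversion graph $G_w$ has vertex set $[n]$ and edges $\{i,j\}$ for $i<j$ with $w_i>w_j$. The south-west diagram is $O_w=\{(i,w_j):1\le i<j\le n,\ w_j>w_i\}\subseteq[n]\times[n]$. A placement of $k$ non-attacking rooks on $O_w$ is a set of $k$ cells of $O_w$ no two in the same row or column ($r_0=1$). The product $t(t-1)\cdots(t-i+1)$ is $1$ for $i=0$. $\chi_G(t)$ is the chromatic polynomial of $G$. *)

theory Defs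
  imports
    "HOL-Computational_Algebra.Polynomial"
    "HOL-Combinatorics.Permutations"
    "HOL-Library.FuncSet"
begin

text \<open>A graph is given by its vertex set \<open>V\<close> and its set \<open>E\<close> of unordered edges.\<close>

definition proper_colourings :: "'a set \<Rightarrow> 'a set set \<Rightarrow> nat \<Rightarrow> ('a \<Rightarrow> nat) set" where
  "proper_colourings V E k =
     {c \<in> V \<rightarrow>\<^sub>E {1..k}. \<forall>u\<in>V. \<forall>v\<in>V. {u, v} \<in> E \<longrightarrow> c u \<noteq> c v}"

text \<open>For finite \<open>V\<close> the description below determines a polynomial; this is
  \<open>ex1_chromatic_polynomial\<close>.\<close>

definition chromatic_polynomial :: "'a set \<Rightarrow> 'a set set \<Rightarrow> int poly" where
  "chromatic_polynomial V E =
     (THE p. \<forall>k::nat. poly p (int k) = int (card (proper_colourings V E k)))"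

lemma poly_eqI_nat:
  fixes p q :: "int poly"
  assumes "\<And>k::nat. poly p (int k) = poly q (int k)"
  shows "p = q"
proof (rule ccontr)
  assume "p \<noteq> q"
  then have "finite {x. poly (p - q) x = 0}"
    by (intro poly_roots_finite) simp
  moreover have "range int \<subseteq> {x. poly (p - q) x = 0}"
    using assms by auto
  ultimately have "finite (range int)"
    by (rule rev_finite_subset)
  then show False
    by (simp add: finite_image_iff)
qed

lemma ex_colouring_polynomial:
  assumes "finite R" "finite V" "R \<subseteq> V \<times> V"
  shows "\<exists>p. \<forall>k::nat. poly p (int k) =
           int (card {c \<in> V \<rightarrow>\<^sub>E {1..k}. \<forall>(u, v)\<in>R. c u \<noteq> c v})"
  using assms
proof (induction "card R" arbitrary: R V rule: less_induct)
  case less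
  show ?case
  proof (cases "R = {}")
    case True
    have "\<forall>k::nat. poly (monom 1 (card V)) (int k) =
        int (card {c \<in> V \<rightarrow>\<^sub>E {1..k}. \<forall>(u, v)\<in>R. c u \<noteq> c v})"
      using True less.prems by (simp add: poly_monom card_PiE)
    then show ?thesis by blast
  next
    case False
    then obtain a b where ab: "(a, b) \<in> R" by auto
    define S where "S = R - {(a, b)}"
    have S: "finite S" "S \<subseteq> V \<times> V" "card S < card R" "R = insert (a, b) S"
      using less.prems ab card_Diff1_less[of R "(a, b)"] unfolding S_def by auto
    have abV: "a \<in> V" "b \<in> V" using ab less.prems by auto
    show ?thesis
    proof (cases "a = b")
      case True
      have empty: "{c \<in> V \<rightarrow>\<^sub>E {1..k}. \<forall>(u, v)\<in>R. c u \<noteq> c v} = {}" for k :: nat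
        using ab True by auto
      show ?thesis unfolding empty by (intro exI[of _ 0]) simp
    next
      case ne: False
      define f where "f = (\<lambda>x. if x = b then a else x)"
      define T where "T = map_prod f f ` S"
      define W where "W = V - {b}"
      have T: "finite T" "card T < card R"
        using S card_image_le[of S "map_prod f f"] by (auto simp: T_def)
      have TW: "T \<subseteq> W \<times> W"
        using S(2) abV ne by (auto simp: T_def W_def f_def split: if_splits)
      obtain p where p: "\<And>k::nat. poly p (int k) =
          int (card {c \<in> V \<rightarrow>\<^sub>E {1..k}. \<forall>(u, v)\<in>S. c u \<noteq> c v})"
        using less.hyps[of S V] S less.prems by blast
      obtain q where q: "\<And>k::nat. poly q (int k) =
          int (card {c \<in> W \<rightarrow>\<^sub>E {1..k}. \<forall>(u, v)\<in>T. c u \<noteq> c v})"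
        using less.hyps[of T W] T TW less.prems unfolding W_def by blast
      have "poly (p - q) (int k) =
          int (card {c \<in> V \<rightarrow>\<^sub>E {1..k}. \<forall>(u, v)\<in>R. c u \<noteq> c v})" for k :: nat
      proof -
        let ?A = "{c \<in> V \<rightarrow>\<^sub>E {1..k}. \<forall>(u, v)\<in>S. c u \<noteq> c v}"
        let ?B = "{c \<in> W \<rightarrow>\<^sub>E {1..k}. \<forall>(u, v)\<in>T. c u \<noteq> c v}"
        let ?C = "{c \<in> ?A. c a = c b}"
        let ?D = "{c \<in> V \<rightarrow>\<^sub>E {1..k}. \<forall>(u, v)\<in>R. c u \<noteq> c v}"
        have finA: "finite ?A"
          using less.prems by (intro finite_subset[OF _ finite_PiE[of V "\<lambda>_. {1..k}"]]) auto
        have D: "?D = ?A - ?C" using S(4) by auto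
        have "card ?D = card ?A - card ?C"
          unfolding D by (rule card_Diff_subset) (blast intro: finite_subset[OF _ finA])+
        moreover have "card ?C \<le> card ?A"
          by (rule card_mono[OF finA]) blast
        moreover have "bij_betw (\<lambda>c. c(b := undefined)) ?C ?B"
        proof (rule bij_betw_byWitness[where f' = "\<lambda>c. c(b := c a)"])
          show "\<forall>c\<in>?C. (c(b := undefined))(b := (c(b := undefined)) a) = c"
            using ne by (auto simp: fun_eq_iff)
          show "\<forall>c\<in>?B. (c(b := c a))(b := undefined) = c"
            by (auto simp: fun_eq_iff W_def PiE_def extensional_def)
          show "(\<lambda>c. c(b := undefined)) ` ?C \<subseteq> ?B"
          proof (rule image_subsetI)
            fix c assume "c \<in> ?C"
            then have c: "c \<in> V \<rightarrow>\<^sub>E {1..k}" "\<forall>(u, v)\<in>S. c u \<noteq> c v" "c a = c b"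
              by auto
            have "(c(b := undefined)) (f x) = c x" for x
              using ne c(3) by (auto simp: f_def)
            then have "\<forall>(u, v)\<in>T. (c(b := undefined)) u \<noteq> (c(b := undefined)) v"
              using c(2) unfolding T_def by (fastforce simp del: fun_upd_apply)
            moreover have "c(b := undefined) \<in> W \<rightarrow>\<^sub>E {1..k}"
              using c(1) by (auto simp: W_def PiE_def extensional_def)
            ultimately show "c(b := undefined) \<in> ?B"
              by blast
          qed
          show "(\<lambda>c. c(b := c a)) ` ?B \<subseteq> ?C"
          proof (rule image_subsetI)
            fix c assume "c \<in> ?B"
            then have c: "c \<in> W \<rightarrow>\<^sub>E {1..k}" "\<forall>(u, v)\<in>T. c u \<noteq> c v"
              by auto
            have "(c(b := c a)) x = c (f x)" for x
              by (auto simp: f_def)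
            then have "\<forall>(u, v)\<in>S. (c(b := c a)) u \<noteq> (c(b := c a)) v"
              using c(2) unfolding T_def by (fastforce simp del: fun_upd_apply)
            moreover have "c(b := c a) \<in> V \<rightarrow>\<^sub>E {1..k}"
              using c(1) abV ne by (auto simp: W_def PiE_def Pi_def extensional_def)
            ultimately show "c(b := c a) \<in> ?C"
              using ne by simp
          qed
        qed
        then have "card ?C = card ?B" by (rule bij_betw_same_card)
        ultimately show ?thesis by (simp add: p q of_nat_diff)
      qed
      then show ?thesis by blast
    qed
  qed
qed

lemma ex1_chromatic_polynomial:
  assumes "finite V"
  shows "\<exists>!p. \<forall>k::nat. poly p (int k) = int (card (proper_colourings V E k))"
proof -
  let ?R = "{(u, v) \<in> V \<times> V. {u, v} \<in> E}"
  have "finite ?R"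
    using assms by (auto intro: finite_subset[of _ "V \<times> V"])
  moreover have "proper_colourings V E k =
      {c \<in> V \<rightarrow>\<^sub>E {1..k}. \<forall>(u, v)\<in>?R. c u \<noteq> c v}" for k
    unfolding proper_colourings_def by auto
  ultimately have "\<exists>p. \<forall>k::nat. poly p (int k) = int (card (proper_colourings V E k))"
    using ex_colouring_polynomial[of ?R V] assms by auto
  then show ?thesis
    by (metis poly_eqI_nat)
qed

text \<open>Permutations of \<open>{1..n}\<close> are functions \<open>w\<close> with \<open>w permutes {1..n}\<close>, in one-line
  notation \<open>w 1, \<dots>, w n\<close>; the inversion graph has vertex set \<open>{1..n}\<close>.\<close>

definition inversion_edges :: "nat \<Rightarrow> (nat \<Rightarrow> nat) \<Rightarrow> nat set set" where
  "inversion_edges n w = {{i, j} | i j. 1 \<le> i \<and> i < j \<and> j \<le> n \<and> w i > w j}"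

definition sw_diagram :: "nat \<Rightarrow> (nat \<Rightarrow> nat) \<Rightarrow> (nat \<times> nat) set" where
  "sw_diagram n w = {(i, w j) | i j. 1 \<le> i \<and> i < j \<and> j \<le> n \<and> w j > w i}"

definition rook_placements :: "(nat \<times> nat) set \<Rightarrow> nat \<Rightarrow> (nat \<times> nat) set set" where
  "rook_placements B k =
     {P. P \<subseteq> B \<and> finite P \<and> card P = k \<and> inj_on fst P \<and> inj_on snd P}"

definition rook_number :: "(nat \<times> nat) set \<Rightarrow> nat \<Rightarrow> nat" where
  "rook_number B k = card (rook_placements B k)"

text \<open>\<open>t(t - 1)\<dots>(t - i + 1)\<close> in the indeterminate \<open>t = [:0, 1:]\<close>.\<close>

definition falling_factorial_poly :: "nat \<Rightarrow> int poly" where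
  "falling_factorial_poly i = (\<Prod>j<i. [:0, 1:] - of_nat j)"

end

theory Submission
  imports Defs
begin

text \<open>Colour classes of \<open>G\<^sub>w\<close> are increasing subsequences of \<open>w\<close>. Linking every position to the next
  position of the same colour turns a proper colouring into a rook placement: the link \<open>i \<rightarrow> j\<close>
  becomes the cell \<open>(i, w j)\<close>. Conversely, the links of any non-attacking placement form disjoint
  paths, which are increasing subsequences by transitivity. A placement of \<open>n - i\<close> rooks leaves
  \<open>i\<close> paths, and the colourings that induce it are the injective colourings of these paths, of
  which there are \<open>t(t - 1)\<dots>(t - i + 1)\<close>.\<close>

section \<open>Links of a colouring\<close>

text \<open>Only the first \<open>m\<close> positions are considered, so that counts can go by
  induction on \<open>m\<close>. The permutation does not enter: which link sets are allowed is a
  separate condition.\<close>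

definition colour_links :: "(nat \<Rightarrow> 'c) \<Rightarrow> nat \<Rightarrow> (nat \<times> nat) set" where
  "colour_links c m =
     {(i, j). 1 \<le> i \<and> i < j \<and> j \<le> m \<and> c i = c j \<and> (\<forall>l. i < l \<and> l < j \<longrightarrow> c l \<noteq> c i)}"

text \<open>These are non-attacking placements in position coordinates: the second entry is the
  position \<open>j\<close> and not the column \<open>w j\<close>, which makes a set of links a
  union of paths in {1..n}.\<close>

definition link_systems :: "(nat \<times> nat) set \<Rightarrow> (nat \<times> nat) set set" where
  "link_systems R = {S. S \<subseteq> R \<and> inj_on fst S \<and> inj_on snd S}"

definition noninversions :: "nat \<Rightarrow> (nat \<Rightarrow> nat) \<Rightarrow> (nat \<times> nat) set" where
  "noninversions n w = {(i, j). 1 \<le> i \<and> i < j \<and> j \<le> n \<and> w i < w j}"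

lemma finite_increasing_pairs: "finite {(i, j). 1 \<le> i \<and> i < j \<and> j \<le> (m::nat)}"
  by (rule finite_subset[of _ "{1..m} \<times> {1..m}"]) auto

lemma colour_links_subset: "colour_links c m \<subseteq> {(i, j). 1 \<le> i \<and> i < j \<and> j \<le> m}"
  by (auto simp: colour_links_def)

lemma colour_links_0 [simp]: "colour_links c 0 = {}"
  by (auto simp: colour_links_def)

lemma finite_colour_links: "finite (colour_links c m)"
  by (rule finite_subset[OF colour_links_subset finite_increasing_pairs])

lemma colour_links_cong:
  assumes "\<And>i. 1 \<le> i \<Longrightarrow> i \<le> m \<Longrightarrow> c i = d i"
  shows "colour_links c m = colour_links d m"
  unfolding colour_links_def using assms by (auto; metis le_trans less_imp_le)

text \<open>Of two later positions of the same colour, the nearer one blocks the link to the farther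
  one; likewise for two earlier positions.\<close>

lemma inj_on_colour_links: "inj_on fst (colour_links c m)" "inj_on snd (colour_links c m)"
proof -
  show "inj_on fst (colour_links c m)"
    unfolding inj_on_def colour_links_def by (auto; metis linorder_neqE_nat)
  show "inj_on snd (colour_links c m)"
    unfolding inj_on_def colour_links_def by (auto; metis linorder_neqE_nat)
qed

lemma colour_links_in_link_systems:
  "colour_links c m \<subseteq> R \<Longrightarrow> colour_links c m \<in> link_systems R"
  by (simp add: link_systems_def inj_on_colour_links)

text \<open>If the colour of \<open>i\<close> recurs, the least recurrence is the target of a link
  from \<open>i\<close>. Thus the positions without outgoing link, the ends of the paths, represent
  the colours used so far.\<close>

lemma last_occurrence_iff:
  assumes "1 \<le> i" "i \<le> m"
  shows "i \<notin> fst ` colour_links c m \<longleftrightarrow> (\<forall>l. i < l \<and> l \<le> m \<longrightarrow> c l \<noteq> c i)"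
proof
  assume i: "i \<notin> fst ` colour_links c m"
  show "\<forall>l. i < l \<and> l \<le> m \<longrightarrow> c l \<noteq> c i"
  proof (rule ccontr)
    assume "\<not> ?thesis"
    then have ex: "\<exists>l. i < l \<and> l \<le> m \<and> c l = c i" by blast
    define l where "l = (LEAST l. i < l \<and> l \<le> m \<and> c l = c i)"
    have l: "i < l \<and> l \<le> m \<and> c l = c i"
      unfolding l_def by (rule LeastI_ex[OF ex])
    have "\<not> (i < l' \<and> l' \<le> m \<and> c l' = c i)" if "l' < l" for l'
      using that not_less_Least unfolding l_def by blast
    then have "(i, l) \<in> colour_links c m"
      using l assms unfolding colour_links_def by auto
    then show False using i by force
  qed
next
  assume last: "\<forall>l. i < l \<and> l \<le> m \<longrightarrow> c l \<noteq> c i"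
  show "i \<notin> fst ` colour_links c m"
  proof
    assume "i \<in> fst ` colour_links c m"
    then obtain j where "i < j" "j \<le> m" "c i = c j" by (auto simp: colour_links_def)
    then show False using last by metis
  qed
qed

text \<open>A link into \<open>Suc m\<close> can only start at the last earlier position of its
  colour, and links into earlier positions do not see \<open>Suc m\<close>.\<close>

lemma colour_links_Suc_link:
  assumes "1 \<le> i" "i \<le> m" "i \<notin> fst ` colour_links c m" "c (Suc m) = c i"
  shows "colour_links c (Suc m) = insert (i, Suc m) (colour_links c m)"
proof -
  have last: "\<forall>l. i < l \<and> l \<le> m \<longrightarrow> c l \<noteq> c i"
    using assms last_occurrence_iff by blast
  have "(i', Suc m) \<in> colour_links c (Suc m) \<longleftrightarrow> i' = i" for i'
  proof
    assume "(i', Suc m) \<in> colour_links c (Suc m)"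
    then have i': "1 \<le> i'" "i' \<le> m" "c i' = c i" "\<forall>l. i' < l \<and> l \<le> m \<longrightarrow> c l \<noteq> c i"
      using assms by (auto simp: colour_links_def)
    show "i' = i"
      using i' last assms by (metis linorder_neqE_nat)
  qed (use assms last in \<open>auto simp: colour_links_def\<close>)
  moreover have "(i', j) \<in> colour_links c (Suc m) \<longleftrightarrow> (i', j) \<in> colour_links c m"
    if "j \<noteq> Suc m" for i' j
    using that by (auto simp: colour_links_def)
  moreover have "(i', Suc m) \<notin> colour_links c m" for i'
    by (simp add: colour_links_def)
  ultimately have "(i', j) \<in> colour_links c (Suc m) \<longleftrightarrow>
      (i', j) \<in> insert (i, Suc m) (colour_links c m)" for i' j
    by (cases "j = Suc m") blast+
  then show ?thesis unfolding set_eq_iff split_paired_All by blast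
qed

lemma colour_links_Suc_new:
  assumes "c (Suc m) \<notin> c ` {1..m}"
  shows "colour_links c (Suc m) = colour_links c m"
proof -
  have "c i \<noteq> c (Suc m)" if "1 \<le> i" "i < Suc m" for i
    using assms that by (metis atLeastAtMost_iff imageI less_Suc_eq_le)
  then show ?thesis by (auto simp: colour_links_def le_Suc_eq)
qed

lemma ex_last_occurrence:
  assumes "x \<in> c ` {1..m}"
  obtains i where "1 \<le> i" "i \<le> m" "i \<notin> fst ` colour_links c m" "c i = x"
proof -
  define A where "A = {i \<in> {1..m}. c i = x}"
  have A: "finite A" "A \<noteq> {}" using assms by (auto simp: A_def)
  define M where "M = Max A"
  have "M \<in> A" unfolding M_def using A by (rule Max_in)
  then have M: "1 \<le> M" "M \<le> m" "c M = x" by (auto simp: A_def)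
  have "c l \<noteq> x" if "M < l" "l \<le> m" for l
  proof
    assume "c l = x"
    then have "l \<in> A" using that by (auto simp: A_def)
    then have "l \<le> M" unfolding M_def by (rule Max_ge[OF A(1)])
    then show False using that(1) by linarith
  qed
  then have "M \<notin> fst ` colour_links c m"
    using M last_occurrence_iff[OF M(1,2)] by metis
  then show ?thesis using M that by metis
qed

text \<open>Each appended position either repeats a colour, which creates exactly one link, or
  introduces a new colour and no link.\<close>

lemma card_colours_add_card_colour_links:
  "card (c ` {1..m}) + card (colour_links c m) = m"
proof (induction m)
  case 0
  then show ?case by simp
next
  case (Suc m)
  have im: "c ` {1..Suc m} = insert (c (Suc m)) (c ` {1..m})"
    by (simp add: atLeastAtMostSuc_conv)
  show ?case
  proof (cases "c (Suc m) \<in> c ` {1..m}")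
    case True
    then obtain i where i: "1 \<le> i" "i \<le> m" "i \<notin> fst ` colour_links c m" "c i = c (Suc m)"
      by (rule ex_last_occurrence)
    have "(i, Suc m) \<notin> colour_links c m" by (auto simp: colour_links_def)
    then show ?thesis
      using colour_links_Suc_link[OF i(1-3)] i(4) Suc True
      unfolding im by (simp add: insert_absorb finite_colour_links)
  next
    case False
    then show ?thesis
      using colour_links_Suc_new[OF False] Suc unfolding im by simp
  qed
qed

section \<open>Counting the colourings with a prescribed link set\<close>

lemma PiE_Suc_upd:
  assumes "c \<in> {1..m} \<rightarrow>\<^sub>E A" "x \<in> A"
  shows "c(Suc m := x) \<in> {1..Suc m} \<rightarrow>\<^sub>E A"
  using assms by (auto simp: PiE_def Pi_def extensional_def)

lemma PiE_Suc_restrict: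
  assumes "c \<in> {1..Suc m} \<rightarrow>\<^sub>E A"
  shows "c(Suc m := undefined) \<in> {1..m} \<rightarrow>\<^sub>E A"
  using assms by (auto simp: PiE_def Pi_def extensional_def)

text \<open>Positions are coloured from left to right. A position that is the target of a link has
  its colour forced; any other position starts a new path and must avoid all colours used so
  far.\<close>

lemma card_colourings_with_links:
  assumes "S \<in> link_systems {(i, j). 1 \<le> i \<and> i < j \<and> j \<le> m}"
  shows "int (card {c \<in> {1..m} \<rightarrow>\<^sub>E {1..k}. colour_links c m = S}) =
    (\<Prod>j<m - card S. int k - int j)"
  using assms
proof (induction m arbitrary: S)
  case 0
  then have "S = {}" by (auto simp: link_systems_def)
  then show ?case by simp
next
  case (Suc m)
  let ?F = "\<lambda>m S. {c \<in> {1..m} \<rightarrow>\<^sub>E {1..k}. colour_links c m = S}"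
  have S: "S \<subseteq> {(i, j). 1 \<le> i \<and> i < j \<and> j \<le> Suc m}" "inj_on fst S" "inj_on snd S"
    using Suc.prems by (auto simp: link_systems_def)
  have finS: "finite S"
    by (rule finite_subset[OF S(1) finite_increasing_pairs])
  have finF: "finite (?F m T)" for T
    by (rule finite_subset[OF _ finite_PiE[of "{1..m}" "\<lambda>_. {1..k}"]]) auto
  have upd: "colour_links (c(Suc m := x)) m = colour_links c m" for c :: "nat \<Rightarrow> nat" and x
    by (rule colour_links_cong) simp
  show ?case
  proof (cases "Suc m \<in> snd ` S")
    case True
    then obtain i where i: "(i, Suc m) \<in> S" by force
    have im: "1 \<le> i" "i \<le> m" using i S(1) by auto
    define T where "T = S - {(i, Suc m)}"
    have ST: "S = insert (i, Suc m) T" "(i, Suc m) \<notin> T" using i by (auto simp: T_def)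
    \<comment> \<open>Injectivity of \<open>snd\<close> leaves no second link into
      \<open>Suc m\<close>, so \<open>T\<close> lives on the first \<open>m\<close>
      positions.\<close>
    have "j \<noteq> Suc m" if "(i', j) \<in> T" for i' j
      using that i S(3) unfolding T_def inj_on_def by fastforce
    then have "T \<in> link_systems {(i, j). 1 \<le> i \<and> i < j \<and> j \<le> m}"
      using S unfolding link_systems_def T_def by (fastforce simp: le_Suc_eq intro: inj_on_diff)
    note IH = Suc.IH[OF this]
    \<comment> \<open>Injectivity of \<open>fst\<close> makes \<open>i\<close> the end of a path of
      \<open>T\<close>, hence the last position of its colour in every colouring with link set
      \<open>T\<close>.\<close>
    have iT: "i \<notin> fst ` T"
      using i S(2) unfolding T_def inj_on_def by fastforce
    \<comment> \<open>The colour of \<open>Suc m\<close> is forced to be that of \<open>i\<close>.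
      The inverse resets it to \<open>undefined\<close>, the value of extensional functions outside
      their domain.\<close>
    have "bij_betw (\<lambda>c. c(Suc m := c i)) (?F m T) (?F (Suc m) S)"
    proof (rule bij_betw_byWitness[where f' = "\<lambda>c. c(Suc m := undefined)"])
      show "\<forall>c\<in>?F m T. (c(Suc m := c i))(Suc m := undefined) = c"
        by (auto simp: fun_eq_iff PiE_def extensional_def)
      show "\<forall>c\<in>?F (Suc m) S.
          (c(Suc m := undefined))(Suc m := (c(Suc m := undefined)) i) = c"
      proof
        fix c assume "c \<in> ?F (Suc m) S"
        then have "(i, Suc m) \<in> colour_links c (Suc m)" using i by simp
        then have "c i = c (Suc m)" by (simp add: colour_links_def)
        then show "(c(Suc m := undefined))(Suc m := (c(Suc m := undefined)) i) = c"
          using im by auto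
      qed
      show "(\<lambda>c. c(Suc m := c i)) ` ?F m T \<subseteq> ?F (Suc m) S"
      proof (rule image_subsetI)
        fix c assume c: "c \<in> ?F m T"
        then have "c i \<in> {1..k}" using im by (auto simp: PiE_def)
        then have "c(Suc m := c i) \<in> {1..Suc m} \<rightarrow>\<^sub>E {1..k}"
          using c by (intro PiE_Suc_upd) auto
        moreover have "colour_links (c(Suc m := c i)) (Suc m) = S"
          using colour_links_Suc_link[of i m "c(Suc m := c i)"] im iT c ST by (simp add: upd)
        ultimately show "c(Suc m := c i) \<in> ?F (Suc m) S" by simp
      qed
      show "(\<lambda>c. c(Suc m := undefined)) ` ?F (Suc m) S \<subseteq> ?F m T"
      proof (rule image_subsetI)
        fix c assume c: "c \<in> ?F (Suc m) S"
        then have L: "(i, Suc m) \<in> colour_links c (Suc m)" using i by simp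
        then have ci: "c (Suc m) = c i" and last: "i \<notin> fst ` colour_links c m"
          using last_occurrence_iff[of i m c] im by (auto simp: colour_links_def)
        have "insert (i, Suc m) (colour_links c m) = S"
          using colour_links_Suc_link[OF im last ci] c by simp
        moreover have "(i, Suc m) \<notin> colour_links c m" by (simp add: colour_links_def)
        ultimately have "colour_links c m = T" using ST by (metis insert_ident)
        then show "c(Suc m := undefined) \<in> ?F m T"
          using c PiE_Suc_restrict[of c m] by (simp add: upd)
      qed
    qed
    then have "card (?F (Suc m) S) = card (?F m T)"
      by (simp add: bij_betw_same_card)
    \<comment> \<open>One more position and one more link: the number of paths, and with it the
      product, is unchanged.\<close>
    moreover have "card S = Suc (card T)" using ST finS by simp
    ultimately show ?thesis using IH by simp
  next
    case False
    then have "S \<subseteq> {(i, j). 1 \<le> i \<and> i < j \<and> j \<le> m}"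
      using S(1) by (force simp: le_Suc_eq)
    then have "S \<in> link_systems {(i, j). 1 \<le> i \<and> i < j \<and> j \<le> m}"
      using S by (simp add: link_systems_def)
    note IH = Suc.IH[OF this]
    \<comment> \<open>A colouring of the first \<open>m\<close> positions together with a fresh
      colour for \<open>Suc m\<close>.\<close>
    let ?D = "SIGMA c:?F m S. {1..k} - c ` {1..m}"
    have "bij_betw (\<lambda>(c, x). c(Suc m := x)) ?D (?F (Suc m) S)"
    proof (rule bij_betw_byWitness[where f' = "\<lambda>c. (c(Suc m := undefined), c (Suc m))"])
      show "\<forall>p\<in>?D. (\<lambda>c. (c(Suc m := undefined), c (Suc m))) ((\<lambda>(c, x). c(Suc m := x)) p) = p"
        by (auto simp: fun_eq_iff PiE_def extensional_def)
      show "\<forall>c\<in>?F (Suc m) S. (\<lambda>(c, x). c(Suc m := x)) (c(Suc m := undefined), c (Suc m)) = c"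
        by auto
      show "(\<lambda>(c, x). c(Suc m := x)) ` ?D \<subseteq> ?F (Suc m) S"
      proof clarify
        fix c x assume c: "c \<in> {1..m} \<rightarrow>\<^sub>E {1..k}" "x \<in> {1..k}" "x \<notin> c ` {1..m}"
        have "(c(Suc m := x)) ` {1..m} = c ` {1..m}" by auto
        then show "c(Suc m := x) \<in> {1..Suc m} \<rightarrow>\<^sub>E {1..k} \<and>
            colour_links (c(Suc m := x)) (Suc m) = colour_links c m"
          using colour_links_Suc_new[of "c(Suc m := x)" m] c(3) upd[of c x]
            PiE_Suc_upd[OF c(1,2)] by simp
      qed
      show "(\<lambda>c. (c(Suc m := undefined), c (Suc m))) ` ?F (Suc m) S \<subseteq> ?D"
      proof (rule image_subsetI)
        fix c assume c: "c \<in> ?F (Suc m) S"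
        \<comment> \<open>A repeated colour would create a link into \<open>Suc m\<close>, which
          \<open>S\<close> does not contain.\<close>
        have new: "c (Suc m) \<notin> c ` {1..m}"
        proof
          assume "c (Suc m) \<in> c ` {1..m}"
          then obtain i where i: "1 \<le> i" "i \<le> m" "i \<notin> fst ` colour_links c m" "c i = c (Suc m)"
            by (rule ex_last_occurrence)
          then have "(i, Suc m) \<in> S"
            using colour_links_Suc_link[OF i(1-3)] c by auto
          then show False using False by force
        qed
        moreover have "(c(Suc m := undefined)) ` {1..m} = c ` {1..m}" by auto
        moreover have "c (Suc m) \<in> {1..k}" using c by (auto simp: PiE_def)
        ultimately show "(c(Suc m := undefined), c (Suc m)) \<in> ?D"
          using c PiE_Suc_restrict[of c m] colour_links_Suc_new[OF new] by (simp add: upd)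
      qed
    qed
    then have "card (?F (Suc m) S) = card ?D"
      by (simp add: bij_betw_same_card)
    also have "\<dots> = (\<Sum>c\<in>?F m S. card ({1..k} - c ` {1..m}))"
      using finF by (simp add: card_SigmaI)
    finally have "int (card (?F (Suc m) S)) = (\<Sum>c\<in>?F m S. int (card ({1..k} - c ` {1..m})))"
      by simp
    also have "\<dots> = (\<Sum>c\<in>?F m S. int k - int (m - card S))"
    proof (rule sum.cong[OF refl])
      fix c assume c: "c \<in> ?F m S"
      have sub: "c ` {1..m} \<subseteq> {1..k}" using c by (auto simp: PiE_def)
      have "card (c ` {1..m}) = m - card S"
        using card_colours_add_card_colour_links[of c m] c by simp
      \<comment> \<open>This bound turns truncated into integer subtraction. It rests on the
        existence of \<open>c\<close>; if \<open>k\<close> is too small for any such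
        \<open>c\<close>, the sum is empty and the product has a zero factor.\<close>
      moreover have "card (c ` {1..m}) \<le> k"
        using card_mono[OF _ sub] by simp
      ultimately show "int (card ({1..k} - c ` {1..m})) = int k - int (m - card S)"
        using sub by (simp add: card_Diff_subset of_nat_diff)
    qed
    also have "\<dots> = (\<Prod>j<Suc (m - card S). int k - int j)"
      using IH by simp
    \<comment> \<open>Truncated subtraction requires \<open>card S \<le> m\<close>: the links have
      distinct sources, all in {1..m}.\<close>
    also have "Suc (m - card S) = Suc m - card S"
    proof -
      have "fst ` S \<subseteq> {1..m}" using \<open>S \<subseteq> {(i, j). 1 \<le> i \<and> i < j \<and> j \<le> m}\<close> by auto
      then have "card S \<le> m"
        using card_inj_on_le[OF S(2), of "{1..m}"] by simp
      then show ?thesis by simp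
    qed
    finally show ?thesis .
  qed
qed

section \<open>Translation to the inversion graph and the diagram\<close>

text \<open>Since \<open><\<close> is transitive, a colour class is increasing under
  \<open>w\<close> as soon as its consecutive members are.\<close>

lemma proper_colouring_iff_colour_links:
  assumes w: "w permutes {1..n}"
  shows "(\<forall>u\<in>{1..n}. \<forall>v\<in>{1..n}. {u, v} \<in> inversion_edges n w \<longrightarrow> c u \<noteq> c v) \<longleftrightarrow>
    colour_links c n \<subseteq> noninversions n w"
proof
  assume L: "\<forall>u\<in>{1..n}. \<forall>v\<in>{1..n}. {u, v} \<in> inversion_edges n w \<longrightarrow> c u \<noteq> c v"
  show "colour_links c n \<subseteq> noninversions n w"
  proof clarify
    fix i j assume "(i, j) \<in> colour_links c n"
    then have ij: "1 \<le> i" "i < j" "j \<le> n" "c i = c j" by (auto simp: colour_links_def)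
    have "w i \<noteq> w j" using permutes_inj[OF w] ij by (auto dest: injD)
    moreover have "\<not> w i > w j"
    proof
      assume "w i > w j"
      then have "{i, j} \<in> inversion_edges n w" using ij by (auto simp: inversion_edges_def)
      then show False using L ij by auto
    qed
    ultimately show "(i, j) \<in> noninversions n w" using ij by (simp add: noninversions_def)
  qed
next
  assume R: "colour_links c n \<subseteq> noninversions n w"
  have less: "w i < w j" if "1 \<le> i" "i < j" "j \<le> n" "c i = c j" for i j
    using that
  proof (induction "j - i" arbitrary: i j rule: less_induct)
    case less
    show ?case
    proof (cases "(i, j) \<in> colour_links c n")
      case True
      then show ?thesis using R by (auto simp: noninversions_def)
    next
      case False
      \<comment> \<open>Two positions of one colour that are not linked have a third of that colour
        between them; both gaps are shorter, so the induction on \<open>j - i\<close>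
        applies.\<close>
      then obtain l where l: "i < l" "l < j" "c l = c i"
        using less.prems by (auto simp: colour_links_def)
      have "w i < w l" using l less.prems by (intro less.hyps) auto
      also have "w l < w j" using l less.prems by (intro less.hyps) auto
      finally show ?thesis .
    qed
  qed
  show "\<forall>u\<in>{1..n}. \<forall>v\<in>{1..n}. {u, v} \<in> inversion_edges n w \<longrightarrow> c u \<noteq> c v"
  proof (intro ballI impI)
    fix u v assume "{u, v} \<in> inversion_edges n w"
    then obtain i j where ij: "{u, v} = {i, j}" "1 \<le> i" "i < j" "j \<le> n" "w j < w i"
      by (auto simp: inversion_edges_def)
    then have "c i \<noteq> c j" using less[of i j] by auto
    then show "c u \<noteq> c v" using ij(1) by (auto simp: doubleton_eq_iff)
  qed
qed

text \<open>The injection \<open>(i, j) \<mapsto> (i, w j)\<close> carries the noninversions onto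
  the diagram; it keeps rows and relabels columns, so it respects the non-attacking
  condition.\<close>

lemma rook_number_sw_diagram:
  assumes w: "w permutes {1..n}"
  shows "rook_number (sw_diagram n w) k =
    card {S \<in> link_systems (noninversions n w). card S = k}"
proof -
  let ?f = "map_prod id w :: nat \<times> nat \<Rightarrow> nat \<times> nat"
  let ?R = "noninversions n w"
  have injw: "inj w" by (rule permutes_inj[OF w])
  have injf: "inj ?f" using injw by (intro prod.inj_map) auto
  have D: "sw_diagram n w = ?f ` ?R"
    by (force simp: sw_diagram_def noninversions_def)
  have finR: "finite ?R"
    by (rule finite_subset[OF _ finite_increasing_pairs[of n]]) (auto simp: noninversions_def)
  have iff: "inj_on fst (?f ` S) = inj_on fst S" "inj_on snd (?f ` S) = inj_on snd S" for S
    using injw by (auto simp: inj_on_def dest: injD; fastforce)+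
  have "rook_placements (sw_diagram n w) k = (`) ?f ` {S \<in> link_systems ?R. card S = k}"
  proof (intro equalityI subsetI)
    fix P assume P: "P \<in> rook_placements (sw_diagram n w) k"
    then obtain S where S: "S \<subseteq> ?R" "P = ?f ` S"
      unfolding rook_placements_def D by (auto simp: subset_image_iff)
    have "card S = k"
      using P S card_image[OF inj_on_subset[OF injf subset_UNIV], of S]
      by (simp add: rook_placements_def)
    then have "S \<in> {S \<in> link_systems ?R. card S = k}"
      using P S iff[of S] by (simp add: rook_placements_def link_systems_def)
    then show "P \<in> (`) ?f ` {S \<in> link_systems ?R. card S = k}" using S by blast
  next
    fix P assume "P \<in> (`) ?f ` {S \<in> link_systems ?R. card S = k}"
    then obtain S where S: "S \<in> link_systems ?R" "card S = k" "P = ?f ` S" by blast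
    then show "P \<in> rook_placements (sw_diagram n w) k"
      using iff[of S] finite_subset[OF _ finR, of S]
        card_image[OF inj_on_subset[OF injf subset_UNIV], of S]
      unfolding rook_placements_def link_systems_def D by auto
  qed
  moreover have "inj ((`) ?f)" using injf by (simp add: inj_image_eq_iff inj_def)
  ultimately show ?thesis
    unfolding rook_number_def by (simp add: card_image inj_on_subset)
qed

section \<open>Summation over link systems\<close>

lemma poly_falling_factorial_poly:
  "poly (falling_factorial_poly i) x = (\<Prod>j<i. x - int j)"
  by (simp add: falling_factorial_poly_def poly_prod)

lemma card_proper_colourings_inversion_graph:
  assumes w: "w permutes {1..n}"
  shows "int (card (proper_colourings {1..n} (inversion_edges n w) k)) =
    (\<Sum>i=0..n. int (rook_number (sw_diagram n w) (n - i)) * (\<Prod>j<i. int k - int j))"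
proof -
  let ?R = "noninversions n w"
  let ?L = "link_systems ?R"
  let ?F = "\<lambda>S. {c \<in> {1..n} \<rightarrow>\<^sub>E {1..k}. colour_links c n = S}"
  let ?g = "\<lambda>i. \<Prod>j<i. int k - int j"
  have sub: "?R \<subseteq> {(i, j). 1 \<le> i \<and> i < j \<and> j \<le> n}" by (auto simp: noninversions_def)
  have finR: "finite ?R"
    by (rule finite_subset[OF sub finite_increasing_pairs])
  have finL: "finite ?L"
    by (rule finite_subset[of _ "Pow ?R"]) (use finR in \<open>auto simp: link_systems_def\<close>)
  have finF: "finite (?F S)" for S
    by (rule finite_subset[OF _ finite_PiE[of "{1..n}" "\<lambda>_. {1..k}"]]) auto
  have cardS: "card S \<le> n" if "S \<in> ?L" for S
  proof -
    have "fst ` S \<subseteq> {1..n}" "inj_on fst S"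
      using that sub by (auto simp: link_systems_def)
    then show ?thesis using card_inj_on_le[of fst S "{1..n}"] by simp
  qed
  have "proper_colourings {1..n} (inversion_edges n w) k =
      {c \<in> {1..n} \<rightarrow>\<^sub>E {1..k}. colour_links c n \<subseteq> ?R}"
    unfolding proper_colourings_def proper_colouring_iff_colour_links[OF w] ..
  \<comment> \<open>Every colouring lies in the fibre of its own link set, which is automatically a
    link system; distinct fibres are disjoint.\<close>
  also have "\<dots> = (\<Union>S\<in>?L. ?F S)"
    using colour_links_in_link_systems[of _ n ?R] by (auto simp: link_systems_def)
  finally have "card (proper_colourings {1..n} (inversion_edges n w) k) = card (\<Union>S\<in>?L. ?F S)"
    by simp
  also have "\<dots> = (\<Sum>S\<in>?L. card (?F S))"
    by (rule card_UN_disjoint) (use finL finF in auto)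
  finally have "int (card (proper_colourings {1..n} (inversion_edges n w) k)) =
      (\<Sum>S\<in>?L. int (card (?F S)))" by simp
  also have "\<dots> = (\<Sum>S\<in>?L. ?g (n - card S))"
    by (intro sum.cong refl card_colourings_with_links)
       (use sub in \<open>auto simp: link_systems_def\<close>)
  \<comment> \<open>Link systems are grouped by their number \<open>i\<close> of paths.\<close>
  also have "\<dots> = (\<Sum>i=0..n. \<Sum>S\<in>{S\<in>?L. n - card S = i}. ?g (n - card S))"
    by (rule sum.group[symmetric]) (use finL in auto)
  also have "\<dots> = (\<Sum>i=0..n. int (rook_number (sw_diagram n w) (n - i)) * ?g i)"
  proof (rule sum.cong[OF refl])
    fix i assume "i \<in> {0..n}"
    \<comment> \<open>With \<open>card S \<le> n\<close> and \<open>i \<le> n\<close>, truncation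
      does no harm and \<open>i\<close> paths mean exactly \<open>n - i\<close> rooks.\<close>
    then have "{S \<in> ?L. n - card S = i} = {S \<in> ?L. card S = n - i}"
      using cardS by fastforce
    then show "(\<Sum>S\<in>{S\<in>?L. n - card S = i}. ?g (n - card S)) =
        int (rook_number (sw_diagram n w) (n - i)) * ?g i"
      using \<open>i \<in> {0..n}\<close> by (simp add: rook_number_sw_diagram[OF w])
  qed
  finally show ?thesis .
qed

theorem theoremA1:
  fixes n :: nat and w :: "nat \<Rightarrow> nat"
  assumes "w permutes {1..n}"
  shows "chromatic_polynomial {1..n} (inversion_edges n w) =
    (\<Sum>i=0..n. of_nat (rook_number (sw_diagram n w) (n - i)) * falling_factorial_poly i)"
  unfolding chromatic_polynomial_def
  \<comment> \<open>By uniqueness of the chromatic polynomial, it suffices that the right-hand side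
    takes the correct value at every natural number \<open>k\<close>.\<close>
  by (rule the1_equality[OF ex1_chromatic_polynomial])
     (simp_all add: card_proper_colourings_inversion_graph[OF assms] poly_sum
       poly_falling_factorial_poly del: One_nat_def)

end
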